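(* Let $X^0$ be a set of mutually nondominated points and let $x_0\in X^0$ be a point such that the set $\mathcal{L}(x_0)=\bigcup_{j=1}^m\{x\in\mathbb{R}^n\mid f_j(x)\le f_j(x_0)\}$ is compact. Let $\{X^k\}$ be the sequence of sets of nondominated points produced by the Front Descent algorithm (described in the context) with $\sigma_k\to0$. Let $\{x_{j_k}\}$ be a linked sequence. Then $\{x_{j_k}\}$ admits accumulation points and every accumulation point is Pareto-stationary for the problem $\min_{x\in\mathbb{R}^n}F(x)$.
   Context: Setting. $F=(f_1,\ldots,f_m)^\top:\mathbb{R}^n\to\mathbb{R}^m$ is continuously differentiable. For $u,w\in\mathbb{R}^m$: $u\le w$ means $u_i\le w_i$ for all $i$; $u<w$ means $u_i<w_i$ for all $i$; $u\lneqq w$ means $u\le w$ and $u\ne w$. A point $y$ is dominated by $x$ if $F(x)\lneqq F(y)$. A set of points is mutually nondominated if none of its points is dominated by another one. $\mathbf{1}\in\mathbb{R}^m$ is the all-ones vector. For $x,d\in\mathbb{R}^n$ let $\mathcal{D}(x,d)=\max_{j=1,\ldots,m}\nabla f_j(x)^\top d$. For nonempty $I\subseteq\{1,\ldots,m\}$ let $\theta^I(x)=\min_{d\in\mathbb{R}^n}\max_{j\in I}\nabla f_j(x)^\top d+\frac12\|d\|^2$ and let $v^I(x)$ be the unique minimizer; $\theta$ and $v$ denote $\theta^I$ and $v^I$ for $I=\{1,\ldots,m\}$. A common descent direction at $x$ is a direction that is a descent direction at $x$ for every $f_j$. A point $\bar x$ is Pareto-stationary if $\min_d\max_j\nabla f_j(\bar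 x)^\top d=0$, equivalently $\theta(\bar x)=0$. Front Descent algorithm. Input: a nonempty finite set $X^0$ of mutually nondominated points; $\alpha_0>0$, $\delta\in(0,1)$, $\gamma\in(0,1)$, $\Gamma_1>0$, $\Gamma_2>0$, a sequence $\{\sigma_k\}\subseteq\mathbb{R}_+$ (nonnegative reals). The algorithm is run without stopping, producing an infinite sequence $\{X^k\}$. At iteration $k=0,1,\ldots$: set $\hat X^k=X^k$; then, sequentially for all $x_c\in X^k$, if $x_c\in\hat X^k$ at that moment, process $x_c$ as follows. (1) Refinement. If $\theta(x_c)<-\sigma_k$: compute a common descent direction $v_D(x_c)$ (arbitrary); if both $\mathcal{D}(x_c,v_D(x_c))\le-\Gamma_1\|v(x_c)\|^2$ and $\|v_D(x_c)\|\le\Gamma_2\|v(x_c)\|$, set $d_c=v_D(x_c)$, otherwise set $d_c=v(x_c)$; set $\alpha_c^k=\max_{h\in\mathbb{N}}\{\alpha_0\delta^h\mid F(x_c+\alpha_0\delta^hd_c)\le F(x_c)+\mathbf{1}\gamma\alpha_0\delta^h\mathcal{D}(x_c,d_c)\}$. Otherwise (if $\theta(x_c)\ge-\sigma_k$) set $d_c=v(x_c)$, $\alpha_c^k=0$. In both cases set $z_c^k=x_c+\alpha_c^kd_c$ and update $\hat X^k\leftarrow\hat X^k\setminus\{y\in\hat X^k\mid F(z_c^k)\lneqq F(y)\}\cup\{z_c^k\}$. (2) Exploration. For every nonempty proper subset $I\subsetneq\{1,\ldots,m\}$ with $\theta^I(z_c^k)<0$: if $z_c^k\in\hat X^k$ at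 that moment, set $\alpha_c^I=\max_{h\in\mathbb{N}}\{\alpha_0\delta^h\mid\forall y\in\hat X^k\ \exists j:\ f_j(z_c^k+\alpha_0\delta^hv^I(z_c^k))<f_j(y)\}$, let $w=z_c^k+\alpha_c^Iv^I(z_c^k)$ and update $\hat X^k\leftarrow\hat X^k\setminus\{y\in\hat X^k\mid F(w)\lneqq F(y)\}\cup\{w\}$. After all points have been considered, set $X^{k+1}=\hat X^k$. Linked sequence. A sequence $\{x_{j_k}\}$ such that, for every $k=1,2,\ldots$, the point $x_{j_k}\in X^k$ is generated at iteration $k-1$ of the algorithm (as the refinement point $z$ or as one of the exploration points $w$) while processing the point $x_{j_{k-1}}\in X^{k-1}$. *)

theory Defs
  imports "HOL-Analysis.Analysis"
begin

definition grad :: "(real^'n \<Rightarrow> real^'m) \<Rightarrow> 'm \<Rightarrow> real^'n \<Rightarrow> real^'n" where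
  "grad F j x = (THE g. GDERIV (\<lambda>y. F y $ j) x :> g)"

definition continuously_differentiable :: "(real^'n \<Rightarrow> real^'m) \<Rightarrow> bool" where
  "continuously_differentiable F \<longleftrightarrow>
     (\<forall>x. F differentiable (at x)) \<and> (\<forall>j. continuous_on UNIV (grad F j))"

text \<open>The order \<open>\<le>\<close> on \<open>real^'m\<close> is the componentwise one. Its library strict part \<open><\<close> is
  not the componentwise strict order, so it is not used below.\<close>

definition dominates :: "(real^'n \<Rightarrow> real^'m) \<Rightarrow> real^'n \<Rightarrow> real^'n \<Rightarrow> bool" where
  "dominates F x y \<longleftrightarrow> F x \<le> F y \<and> F x \<noteq> F y"

definition mutually_nondominated :: "(real^'n \<Rightarrow> real^'m) \<Rightarrow> (real^'n) set \<Rightarrow> bool" where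
  "mutually_nondominated F S \<longleftrightarrow> (\<forall>x\<in>S. \<forall>y\<in>S. \<not> dominates F x y)"

definition is_minimum :: "real set \<Rightarrow> real \<Rightarrow> bool" where
  "is_minimum S a \<longleftrightarrow> a \<in> S \<and> (\<forall>s\<in>S. a \<le> s)"

definition is_maximum :: "real set \<Rightarrow> real \<Rightarrow> bool" where
  "is_maximum S a \<longleftrightarrow> a \<in> S \<and> (\<forall>s\<in>S. s \<le> a)"

definition max_slope :: "(real^'n \<Rightarrow> real^'m) \<Rightarrow> 'm set \<Rightarrow> real^'n \<Rightarrow> real^'n \<Rightarrow> real" where
  "max_slope F I x d = (MAX j\<in>I. grad F j x \<bullet> d)"

abbreviation max_slope_all :: "(real^'n \<Rightarrow> real^'m) \<Rightarrow> real^'n \<Rightarrow> real^'n \<Rightarrow> real" where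
  "max_slope_all F \<equiv> max_slope F UNIV"

text \<open>The functions \<open>\<theta>\<^sup>I\<close> and \<open>v\<^sup>I\<close>. For nonempty \<open>I\<close> the objective is continuous, coercive and
  strictly convex in \<open>d\<close>, so the infimum is a minimum and the minimizer is unique.\<close>

definition theta :: "(real^'n \<Rightarrow> real^'m) \<Rightarrow> 'm set \<Rightarrow> real^'n \<Rightarrow> real" where
  "theta F I x = (INF d. max_slope F I x d + (norm d)\<^sup>2 / 2)"

definition vdir :: "(real^'n \<Rightarrow> real^'m) \<Rightarrow> 'm set \<Rightarrow> real^'n \<Rightarrow> real^'n" where
  "vdir F I x = (THE d. is_arg_min (\<lambda>d. max_slope F I x d + (norm d)\<^sup>2 / 2) (\<lambda>_. True) d)"

text \<open>The minimum over \<open>d\<close> is required to be attained and equal to \<open>0\<close>: at nonstationary points the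
  slopes are unbounded below, where \<open>Inf\<close> on the reals carries no information.\<close>

definition pareto_stationary :: "(real^'n \<Rightarrow> real^'m) \<Rightarrow> real^'n \<Rightarrow> bool" where
  "pareto_stationary F x \<longleftrightarrow> is_minimum (range (max_slope_all F x)) 0"

definition descent_direction :: "(real^'n \<Rightarrow> real) \<Rightarrow> real^'n \<Rightarrow> real^'n \<Rightarrow> bool" where
  "descent_direction f x d \<longleftrightarrow> (\<exists>T>0. \<forall>t. 0 < t \<and> t \<le> T \<longrightarrow> f (x + t *\<^sub>R d) < f x)"

definition common_descent_direction :: "(real^'n \<Rightarrow> real^'m) \<Rightarrow> real^'n \<Rightarrow> real^'n \<Rightarrow> bool" where
  "common_descent_direction F x d \<longleftrightarrow> (\<forall>j. descent_direction (\<lambda>y. F y $ j) x d)"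


text \<open>The algorithm leaves open the order in which points and index sets are visited and the
  choice of \<open>v\<^sub>D\<close>, so it is modelled as a relation. The working set \<open>Xhat\<close> is threaded through as
  \<open>Y\<close> (before) and \<open>Y'\<close> (after).\<close>

definition insert_point ::
  "(real^'n \<Rightarrow> real^'m) \<Rightarrow> real^'n \<Rightarrow> (real^'n) set \<Rightarrow> (real^'n) set" where
  "insert_point F z Y = (Y - {y \<in> Y. dominates F z y}) \<union> {z}"

definition armijo_steps ::
  "(real^'n \<Rightarrow> real^'m) \<Rightarrow> real \<Rightarrow> real \<Rightarrow> real \<Rightarrow> real^'n \<Rightarrow> real^'n \<Rightarrow> real set" where
  "armijo_steps F \<alpha>0 \<delta> \<gamma> x d =
     {\<alpha>0 * \<delta> ^ h | h::nat.
        F (x + (\<alpha>0 * \<delta> ^ h) *\<^sub>R d) \<le> F x + (\<gamma> * (\<alpha>0 * \<delta> ^ h) * max_slope_all F x d) *\<^sub>R 1}"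

definition exploration_steps ::
  "(real^'n \<Rightarrow> real^'m) \<Rightarrow> real \<Rightarrow> real \<Rightarrow> (real^'n) set \<Rightarrow> real^'n \<Rightarrow> real^'n \<Rightarrow> real set" where
  "exploration_steps F \<alpha>0 \<delta> Y z d =
     {\<alpha>0 * \<delta> ^ h | h::nat. \<forall>y\<in>Y. \<exists>j. F (z + (\<alpha>0 * \<delta> ^ h) *\<^sub>R d) $ j < F y $ j}"

text \<open>\<open>refinement \<dots> s x d a\<close>: with \<open>s = \<sigma>\<^sub>k\<close>, the pair \<open>(d, a)\<close> is an admissible choice of
  direction \<open>d\<^sub>c\<close> and stepsize \<open>\<alpha>\<^sub>c\<^sup>k\<close> at \<open>x\<close>.\<close>

definition refinement ::
  "(real^'n \<Rightarrow> real^'m) \<Rightarrow> real \<Rightarrow> real \<Rightarrow> real \<Rightarrow> real \<Rightarrow> real \<Rightarrow> real \<Rightarrow>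
     real^'n \<Rightarrow> real^'n \<Rightarrow> real \<Rightarrow> bool" where
  "refinement F \<alpha>0 \<delta> \<gamma> \<Gamma>1 \<Gamma>2 s x d a \<longleftrightarrow>
     (if theta F UNIV x < - s
      then (\<exists>vD. common_descent_direction F x vD \<and>
              d = (if max_slope_all F x vD \<le> - \<Gamma>1 * (norm (vdir F UNIV x))\<^sup>2 \<and>
                      norm vD \<le> \<Gamma>2 * norm (vdir F UNIV x)
                   then vD else vdir F UNIV x)) \<and>
           is_maximum (armijo_steps F \<alpha>0 \<delta> \<gamma> x d) a
      else d = vdir F UNIV x \<and> a = 0)"

text \<open>\<open>exploration F \<alpha>0 \<delta> z Is Y Y' W\<close>: visiting the index sets in the order \<open>Is\<close> turns \<open>Y\<close> into
  \<open>Y'\<close>, and \<open>W\<close> is the set of all exploration points generated on the way.\<close>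

inductive exploration ::
  "(real^'n \<Rightarrow> real^'m) \<Rightarrow> real \<Rightarrow> real \<Rightarrow> real^'n \<Rightarrow> 'm set list \<Rightarrow>
     (real^'n) set \<Rightarrow> (real^'n) set \<Rightarrow> (real^'n) set \<Rightarrow> bool"
  for F \<alpha>0 \<delta> z where
  finished: "exploration F \<alpha>0 \<delta> z [] Y Y {}"
| skip: "exploration F \<alpha>0 \<delta> z (I # Is) Y Y' W"
    if "z \<notin> Y" and "exploration F \<alpha>0 \<delta> z Is Y Y' W"
| explore: "exploration F \<alpha>0 \<delta> z (I # Is) Y Y' (insert w W)"
    if "z \<in> Y"
      and "is_maximum (exploration_steps F \<alpha>0 \<delta> Y z (vdir F I z)) a"
      and "w = z + a *\<^sub>R vdir F I z"
      and "exploration F \<alpha>0 \<delta> z Is (insert_point F w Y) Y' W"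

text \<open>Processing one point \<open>x\<close>; \<open>G\<close> collects the points \<open>z\<close> and \<open>w\<close> generated meanwhile.\<close>

definition process_point ::
  "(real^'n \<Rightarrow> real^'m) \<Rightarrow> real \<Rightarrow> real \<Rightarrow> real \<Rightarrow> real \<Rightarrow> real \<Rightarrow> real \<Rightarrow>
     real^'n \<Rightarrow> (real^'n) set \<Rightarrow> (real^'n) set \<Rightarrow> (real^'n) set \<Rightarrow> bool" where
  "process_point F \<alpha>0 \<delta> \<gamma> \<Gamma>1 \<Gamma>2 s x Y Y' G \<longleftrightarrow>
     (\<exists>d a z Is W.
        refinement F \<alpha>0 \<delta> \<gamma> \<Gamma>1 \<Gamma>2 s x d a \<and>
        z = x + a *\<^sub>R d \<and>
        distinct Is \<and> set Is = {I. I \<noteq> {} \<and> I \<noteq> UNIV \<and> theta F I z < 0} \<and>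
        exploration F \<alpha>0 \<delta> z Is (insert_point F z Y) Y' W \<and>
        G = insert z W)"

text \<open>\<open>(x, y) \<in> L\<close> records that \<open>y\<close> is generated while \<open>x\<close> is processed.\<close>

inductive iteration ::
  "(real^'n \<Rightarrow> real^'m) \<Rightarrow> real \<Rightarrow> real \<Rightarrow> real \<Rightarrow> real \<Rightarrow> real \<Rightarrow> real \<Rightarrow>
     (real^'n) list \<Rightarrow> (real^'n) set \<Rightarrow> (real^'n) set \<Rightarrow> ((real^'n) \<times> (real^'n)) set \<Rightarrow> bool"
  for F \<alpha>0 \<delta> \<gamma> \<Gamma>1 \<Gamma>2 s where
  finished: "iteration F \<alpha>0 \<delta> \<gamma> \<Gamma>1 \<Gamma>2 s [] Y Y {}"
| skip: "iteration F \<alpha>0 \<delta> \<gamma> \<Gamma>1 \<Gamma>2 s (x # xs) Y Y' L"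
    if "x \<notin> Y" and "iteration F \<alpha>0 \<delta> \<gamma> \<Gamma>1 \<Gamma>2 s xs Y Y' L"
| process: "iteration F \<alpha>0 \<delta> \<gamma> \<Gamma>1 \<Gamma>2 s (x # xs) Y Y'' ({x} \<times> G \<union> L)"
    if "x \<in> Y"
      and "process_point F \<alpha>0 \<delta> \<gamma> \<Gamma>1 \<Gamma>2 s x Y Y' G"
      and "iteration F \<alpha>0 \<delta> \<gamma> \<Gamma>1 \<Gamma>2 s xs Y' Y'' L"

text \<open>An infinite run \<open>X\<close> together with its generation log: \<open>(x, y) \<in> Gen k\<close> means that \<open>y\<close> is
  generated at iteration \<open>k\<close> while processing \<open>x\<close>.\<close>

definition front_descent_run ::
  "(real^'n \<Rightarrow> real^'m) \<Rightarrow> real \<Rightarrow> real \<Rightarrow> real \<Rightarrow> real \<Rightarrow> real \<Rightarrow> (nat \<Rightarrow> real) \<Rightarrow>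
     (nat \<Rightarrow> (real^'n) set) \<Rightarrow> (nat \<Rightarrow> ((real^'n) \<times> (real^'n)) set) \<Rightarrow> bool" where
  "front_descent_run F \<alpha>0 \<delta> \<gamma> \<Gamma>1 \<Gamma>2 \<sigma> X Gen \<longleftrightarrow>
     (\<forall>k. \<exists>xs. distinct xs \<and> set xs = X k \<and>
            iteration F \<alpha>0 \<delta> \<gamma> \<Gamma>1 \<Gamma>2 (\<sigma> k) xs (X k) (X (Suc k)) (Gen k))"

definition linked_sequence ::
  "(nat \<Rightarrow> (real^'n) set) \<Rightarrow> (nat \<Rightarrow> ((real^'n) \<times> (real^'n)) set) \<Rightarrow> (nat \<Rightarrow> real^'n) \<Rightarrow> bool" where
  "linked_sequence X Gen x \<longleftrightarrow> (\<forall>k. x k \<in> X k) \<and> (\<forall>k. (x k, x (Suc k)) \<in> Gen k)"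

definition accumulation_point :: "(nat \<Rightarrow> real^'n) \<Rightarrow> real^'n \<Rightarrow> bool" where
  "accumulation_point x l \<longleftrightarrow> (\<exists>r. strict_mono r \<and> (x \<circ> r) \<longlonglongrightarrow> l)"

end

(* Refinement never increases F and an exploration point is not dominated, so every X k stays
   mutually nondominated and keeps a point at least as good as any earlier one; in particular all
   iterates lie in the compact set L(x0). If an accumulation point were not stationary, then by
   continuity of the gradients the Armijo steps near it would be bounded away from 0, and
   refinement would decrease every objective by a fixed amount kappa > 0. Nondomination makes each
   later iterate inherit this decrease in some objective, while along the convergent subsequence
   the values of F become closer than kappa. *)
theory Submission
  imports Defs
begin

section \<open>Gradients of the components\<close>

lemma gderiv_grad:
  fixes F :: "real^'n \<Rightarrow> real^'m"
  assumes "F differentiable (at x)"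
  shows "GDERIV (\<lambda>y. F y $ j) x :> grad F j x"
proof -
  obtain F' where F': "(F has_derivative F') (at x)"
    using assms unfolding differentiable_def by blast
  have d: "((\<lambda>y. F y $ j) has_derivative (\<lambda>h. F' h $ j)) (at x)"
    by (rule bounded_linear.has_derivative[OF bounded_linear_vec_nth F'])
  have lin: "linear (\<lambda>h. F' h $ j)"
    using d has_derivative_linear by blast
  \<comment> \<open>The derivative of component \<open>j\<close> is a linear functional; its adjoint
    at the real number \<open>1\<close> is the vector that represents it.\<close>
  define g where "g = adjoint (\<lambda>h. F' h $ j) 1"
  have "(\<lambda>h. F' h $ j) = (\<lambda>h. h \<bullet> g)"
    using adjoint_works[OF lin, of _ "1::real"] by (simp add: g_def fun_eq_iff)
  with d have g: "GDERIV (\<lambda>y. F y $ j) x :> g"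
    unfolding gderiv_def by simp
  have uniq: "g = g'" if "GDERIV (\<lambda>y. F y $ j) x :> g" "GDERIV (\<lambda>y. F y $ j) x :> g'" for g g'
  proof -
    have "(\<lambda>h. h \<bullet> g) = (\<lambda>h. h \<bullet> g')"
      using that has_derivative_unique unfolding gderiv_def by blast
    then have "\<forall>h. h \<bullet> g = h \<bullet> g'" unfolding fun_eq_iff .
    then show ?thesis unfolding vector_eq_ldot .
  qed
  show ?thesis
    unfolding grad_def by (rule theI, rule g, rule uniq[OF _ g])
qed

text \<open>The filter is \<open>nhds x\<close> and not \<open>at x\<close> because iterates may
  coincide with the limit point, so the later eventual estimates have to hold at that point
  too.\<close>

lemma tendsto_grad:
  assumes "continuously_differentiable F"
  shows "(grad F j \<longlongrightarrow> grad F j x) (nhds x)"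
proof -
  have "isCont (grad F j) x"
    using assms unfolding continuously_differentiable_def
    by (simp add: continuous_on_eq_continuous_at)
  then show ?thesis
    by (simp add: isCont_def tendsto_at_iff_tendsto_nhds)
qed

lemma grad_mean_value:
  fixes F :: "real^'n \<Rightarrow> real^'m"
  assumes "continuously_differentiable F" and "0 < t"
  obtains s where "0 < s" "s < t" "F (x + t *\<^sub>R d) $ j - F x $ j = t * (grad F j (x + s *\<^sub>R d) \<bullet> d)"
proof -
  have "((\<lambda>t. F (x + t *\<^sub>R d) $ j) has_real_derivative grad F j (x + s *\<^sub>R d) \<bullet> d) (at s)" for s
  proof -
    have "((\<lambda>y. F y $ j) has_derivative (\<lambda>h. h \<bullet> grad F j (x + s *\<^sub>R d))) (at (x + s *\<^sub>R d))"
      using gderiv_grad assms(1) unfolding gderiv_def continuously_differentiable_def by blast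
    moreover have "((\<lambda>t. x + t *\<^sub>R d) has_derivative (\<lambda>h. h *\<^sub>R d)) (at s)"
      by (auto intro!: derivative_eq_intros)
    ultimately have "((\<lambda>t. F (x + t *\<^sub>R d) $ j) has_derivative
        (\<lambda>h. (h *\<^sub>R d) \<bullet> grad F j (x + s *\<^sub>R d))) (at s)"
      by (rule has_derivative_compose[rotated])
    moreover have "(\<lambda>h. (h *\<^sub>R d) \<bullet> grad F j (x + s *\<^sub>R d)) = (*) (grad F j (x + s *\<^sub>R d) \<bullet> d)"
      by (auto simp: fun_eq_iff inner_commute)
    ultimately show ?thesis unfolding has_field_derivative_def by simp
  qed
  then have "\<exists>s>0. s < t \<and> F (x + t *\<^sub>R d) $ j - F (x + 0 *\<^sub>R d) $ j =
      (t - 0) * (grad F j (x + s *\<^sub>R d) \<bullet> d)"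
    by (rule MVT2[OF assms(2)])
  then obtain s where s: "0 < s" "s < t" "F (x + t *\<^sub>R d) $ j - F (x + 0 *\<^sub>R d) $ j =
      (t - 0) * (grad F j (x + s *\<^sub>R d) \<bullet> d)"
    by blast
  show ?thesis by (rule that[OF s(1,2)]) (use s(3) in simp)
qed

section \<open>The maximal slope, its regularized minimizer \<open>vdir\<close> and the value
  \<open>theta\<close>\<close>

lemma max_slope_ge: "j \<in> I \<Longrightarrow> grad F j x \<bullet> d \<le> max_slope F I x d"
  for I :: "'m::finite set"
  unfolding max_slope_def by (intro Max_ge) auto

lemma max_slope_le_iff:
  "I \<noteq> {} \<Longrightarrow> max_slope F I x d \<le> c \<longleftrightarrow> (\<forall>j\<in>I. grad F j x \<bullet> d \<le> c)"
  for I :: "'m::finite set"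
  unfolding max_slope_def by (subst Max_le_iff) auto

lemma max_slope_less_iff:
  "I \<noteq> {} \<Longrightarrow> max_slope F I x d < c \<longleftrightarrow> (\<forall>j\<in>I. grad F j x \<bullet> d < c)"
  for I :: "'m::finite set"
  unfolding max_slope_def by (subst Max_less_iff) auto

lemma max_slope_attained:
  fixes I :: "'m::finite set"
  assumes "I \<noteq> {}"
  obtains j where "j \<in> I" "max_slope F I x d = grad F j x \<bullet> d"
proof -
  have "max_slope F I x d \<in> (\<lambda>j. grad F j x \<bullet> d) ` I"
    unfolding max_slope_def using assms by (intro Max_in) auto
  then show ?thesis using that by auto
qed

lemma max_slope_scaleR:
  fixes I :: "'m::finite set"
  assumes "I \<noteq> {}" "0 \<le> t"
  shows "max_slope F I x (t *\<^sub>R d) = t * max_slope F I x d"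
proof (rule antisym)
  show "max_slope F I x (t *\<^sub>R d) \<le> t * max_slope F I x d"
    using assms by (auto simp: max_slope_le_iff intro!: mult_left_mono max_slope_ge)
  obtain j where "j \<in> I" "max_slope F I x d = grad F j x \<bullet> d"
    using max_slope_attained[OF assms(1)] .
  then show "t * max_slope F I x d \<le> max_slope F I x (t *\<^sub>R d)"
    using max_slope_ge[of j I F x "t *\<^sub>R d"] by simp
qed

text \<open>A maximum of linear functions is convex; the midpoint case is what the uniqueness of the
  minimizer rests on.\<close>

lemma max_slope_midpoint:
  fixes I :: "'m::finite set"
  assumes "I \<noteq> {}"
  shows "max_slope F I x ((1/2) *\<^sub>R (d + e)) \<le> (max_slope F I x d + max_slope F I x e) / 2"
  unfolding max_slope_le_iff[OF assms]
proof
  fix j assume "j \<in> I"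
  from max_slope_ge[OF this, of F x d] max_slope_ge[OF this, of F x e]
  show "grad F j x \<bullet> (1/2) *\<^sub>R (d + e) \<le> (max_slope F I x d + max_slope F I x e) / 2"
    by (simp add: inner_add_right)
qed

lemma continuous_on_max_slope:
  fixes I :: "'m::finite set"
  assumes "I \<noteq> {}"
  shows "continuous_on S (max_slope F I x)"
proof -
  have "continuous_on S (\<lambda>d. MAX j\<in>I. grad F j x \<bullet> d)"
    using finite[of I] assms
  proof (induction rule: finite_ne_induct)
    case (insert j J)
    have "(\<lambda>d. MAX j\<in>insert j J. grad F j x \<bullet> d) =
        (\<lambda>d. max (grad F j x \<bullet> d) (MAX j\<in>J. grad F j x \<bullet> d))"
      using insert.hyps by (simp add: fun_eq_iff)
    then show ?case by (simp only:) (intro continuous_intros insert.IH)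
  qed (auto intro!: continuous_intros)
  then show ?thesis unfolding max_slope_def[abs_def] .
qed

text \<open>Existence follows from coercivity and compactness of a ball, uniqueness from strict
  convexity of the squared norm; together they make the \<open>THE\<close> in \<open>vdir\<close>
  meaningful.\<close>

lemma vdir_is_arg_min:
  fixes I :: "'m::finite set"
  assumes "I \<noteq> {}"
  shows "is_arg_min (\<lambda>d. max_slope F I x d + (norm d)\<^sup>2 / 2) (\<lambda>_. True) (vdir F I x)"
proof -
  let ?q = "\<lambda>d. max_slope F I x d + (norm d)\<^sup>2 / 2"
  obtain j where j: "j \<in> I" using assms by blast
  \<comment> \<open>Keeping a single index \<open>j\<close> bounds the objective below by
    \<open>norm d * (norm d - R) / 2\<close>, so outside this ball it is at least its value
    \<open>0\<close> at the origin.\<close>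
  define R where "R = 2 * norm (grad F j x)"
  have zero: "?q 0 = 0"
    using max_slope_scaleR[OF assms, of 0 F x 0] by simp
  have outside: "0 \<le> ?q d" if "R \<le> norm d" for d
  proof -
    have "- (norm (grad F j x) * norm d) \<le> grad F j x \<bullet> d"
      using Cauchy_Schwarz_ineq2[of "grad F j x" d] by linarith
    also have "\<dots> \<le> max_slope F I x d" by (rule max_slope_ge[OF j])
    finally have "norm d * (norm d - R) / 2 \<le> ?q d"
      by (simp add: R_def power2_eq_square algebra_simps diff_divide_distrib)
    moreover have "0 \<le> norm d * (norm d - R) / 2" using that by simp
    ultimately show ?thesis by linarith
  qed
  have cont: "continuous_on (cball 0 R) ?q"
    using continuous_on_max_slope[OF assms] by (auto intro!: continuous_intros)
  have "cball (0::real^_) R \<noteq> {}" by (simp add: R_def)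
  from continuous_attains_inf[OF compact_cball this cont]
  obtain v where v: "v \<in> cball 0 R" "\<And>d. d \<in> cball 0 R \<Longrightarrow> ?q v \<le> ?q d"
    by blast
  have min: "?q v \<le> ?q d" for d
  proof (cases "norm d \<le> R")
    case False
    then have "0 \<le> ?q d" using outside by simp
    moreover have "?q v \<le> 0" using v(2)[of 0] zero by (simp add: R_def)
    ultimately show ?thesis by linarith
  qed (use v(2) in simp)
  have uniq: "w = v" if w: "\<And>d. ?q w \<le> ?q d" for w
  proof -
    let ?u = "(1/2) *\<^sub>R (w + v)"
    \<comment> \<open>By this identity the objective at the midpoint lies below the average of its
      values at \<open>w\<close> and \<open>v\<close> by at least
      \<open>(norm (w - v))\<^sup>2 / 8\<close>, which must vanish if both are minimizers.\<close>
    have "(norm ?u)\<^sup>2 = ((norm w)\<^sup>2 + (norm v)\<^sup>2) / 2 - (norm (w - v))\<^sup>2 / 4"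
      by (simp add: power2_norm_eq_inner inner_add inner_diff inner_commute field_simps)
    moreover have "max_slope F I x ?u \<le> (max_slope F I x w + max_slope F I x v) / 2"
      by (rule max_slope_midpoint[OF assms])
    moreover have "?q w \<le> ?q ?u" "?q v \<le> ?q ?u" using w min by blast+
    ultimately have "(norm (w - v))\<^sup>2 \<le> 0" by argo
    then show ?thesis by simp
  qed
  show ?thesis
    unfolding vdir_def
  proof (rule theI)
    show "is_arg_min ?q (\<lambda>_. True) v" using min by (simp add: is_arg_min_linorder)
    show "w = v" if "is_arg_min ?q (\<lambda>_. True) w" for w
      using that uniq by (simp add: is_arg_min_linorder)
  qed
qed

lemma vdir_le:
  fixes I :: "'m::finite set"
  assumes "I \<noteq> {}"
  shows "max_slope F I x (vdir F I x) + (norm (vdir F I x))\<^sup>2 / 2 \<le> max_slope F I x d + (norm d)\<^sup>2 / 2"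
  using vdir_is_arg_min[OF assms, of F x] by (simp add: is_arg_min_linorder)

lemma theta_vdir:
  fixes I :: "'m::finite set"
  assumes "I \<noteq> {}"
  shows "theta F I x = max_slope F I x (vdir F I x) + (norm (vdir F I x))\<^sup>2 / 2"
  unfolding theta_def using vdir_le[OF assms] by (intro cInf_eq_minimum) auto

lemma theta_le:
  fixes I :: "'m::finite set"
  assumes "I \<noteq> {}"
  shows "theta F I x \<le> max_slope F I x d + (norm d)\<^sup>2 / 2"
  unfolding theta_vdir[OF assms] by (rule vdir_le[OF assms])

text \<open>Along the ray through the minimizer \<open>v\<close> the objective is \<open>t D + t\<^sup>2 |v|\<^sup>2 / 2\<close>, minimal
  at \<open>t = 1\<close>; hence \<open>D = - |v|\<^sup>2\<close>.\<close>

lemma max_slope_vdir: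
  fixes I :: "'m::finite set"
  assumes "I \<noteq> {}"
  shows "max_slope F I x (vdir F I x) = - (norm (vdir F I x))\<^sup>2"
proof -
  define D where "D = max_slope F I x (vdir F I x)"
  define N where "N = (norm (vdir F I x))\<^sup>2"
  have ray: "D + N / 2 \<le> t * D + t\<^sup>2 * N / 2" if "0 \<le> t" for t
    using vdir_le[OF assms, of F x "t *\<^sub>R vdir F I x"] that
    by (simp add: max_slope_scaleR[OF assms] D_def N_def power_mult_distrib)
  have "N \<ge> 0" by (simp add: N_def)
  have D0: "D + N / 2 \<le> 0" using ray[of 0] by simp
  show ?thesis
  proof (cases "N = 0")
    case True
    then have "vdir F I x = 0" by (simp add: N_def)
    then have "D = 0" using max_slope_scaleR[OF assms, of 0 F x 0] by (simp add: D_def)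
    with True show ?thesis by (simp add: D_def N_def)
  next
    case False
    then have "N > 0" using \<open>N \<ge> 0\<close> by simp
    \<comment> \<open>\<open>- D / N\<close> minimizes the quadratic
      \<open>t * D + t\<^sup>2 * N / 2\<close>; comparing it with \<open>t = 1\<close> leaves the
      square of \<open>D + N\<close> below zero.\<close>
    have "0 \<le> - D / N" using D0 \<open>N > 0\<close> by (simp add: field_simps)
    from ray[OF this] have "N * (D + N / 2) \<le> N * (- D / N * D + (- D / N)\<^sup>2 * N / 2)"
      using \<open>N > 0\<close> by (simp add: mult_left_mono)
    also have "\<dots> = - D\<^sup>2 / 2" using \<open>N > 0\<close> by (simp add: power2_eq_square field_simps)
    finally have "(D + N)\<^sup>2 \<le> 0" by (simp add: power2_eq_square algebra_simps)
    then show ?thesis by (simp add: D_def N_def)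
  qed
qed

text \<open>Cauchy-Schwarz applied to \<open>max_slope_vdir\<close>. One continuous gradient thus
  bounds \<open>vdir\<close> locally, which spares a proof that \<open>vdir\<close> is
  continuous.\<close>

lemma norm_vdir_le:
  fixes I :: "'m::finite set"
  assumes "j \<in> I"
  shows "norm (vdir F I x) \<le> norm (grad F j x)"
proof -
  let ?v = "vdir F I x"
  have "(norm ?v)\<^sup>2 \<le> - (grad F j x \<bullet> ?v)"
    using max_slope_vdir[of I F x] max_slope_ge[OF assms, of F x ?v] assms by fastforce
  also have "\<dots> \<le> norm (grad F j x) * norm ?v"
    using Cauchy_Schwarz_ineq2[of "grad F j x" ?v] by linarith
  finally show ?thesis
    by (cases "?v = 0") (auto simp: power2_eq_square)
qed

section \<open>The refinement step\<close>

text \<open>The chosen direction either passes both tests or equals \<open>vdir\<close>, which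
  satisfies the same inequalities with constant 1. The \<open>min\<close> and \<open>max\<close>
  merge the two cases, so that later arguments need not know which direction was taken.\<close>

lemma refinement_slope:
  fixes F :: "real^'n \<Rightarrow> real^'m"
  assumes "refinement F \<alpha>0 \<delta> \<gamma> \<Gamma>1 \<Gamma>2 s x d a"
  shows "max_slope_all F x d \<le> - min 1 \<Gamma>1 * (norm (vdir F UNIV x))\<^sup>2"
    and "norm d \<le> max 1 \<Gamma>2 * norm (vdir F UNIV x)"
proof -
  let ?v = "vdir F UNIV x"
  have "max_slope_all F x d \<le> - \<Gamma>1 * (norm ?v)\<^sup>2 \<and> norm d \<le> \<Gamma>2 * norm ?v \<or> d = ?v"
    using assms unfolding refinement_def by (auto split: if_splits)
  moreover have "min 1 \<Gamma>1 * (norm ?v)\<^sup>2 \<le> \<Gamma>1 * (norm ?v)\<^sup>2" "min 1 \<Gamma>1 * (norm ?v)\<^sup>2 \<le> 1 * (norm ?v)\<^sup>2"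
    "\<Gamma>2 * norm ?v \<le> max 1 \<Gamma>2 * norm ?v" "1 * norm ?v \<le> max 1 \<Gamma>2 * norm ?v"
    by (intro mult_right_mono; simp)+
  ultimately show "max_slope_all F x d \<le> - min 1 \<Gamma>1 * (norm ?v)\<^sup>2"
    and "norm d \<le> max 1 \<Gamma>2 * norm ?v"
    using max_slope_vdir[of UNIV F x] by auto
qed

lemma refinement_decrease:
  fixes F :: "real^'n \<Rightarrow> real^'m"
  assumes "refinement F \<alpha>0 \<delta> \<gamma> \<Gamma>1 \<Gamma>2 s x d a" "0 < \<alpha>0" "0 < \<delta>" "0 < \<gamma>" "0 < \<Gamma>1"
  shows "F (x + a *\<^sub>R d) \<le> F x"
proof (cases "theta F UNIV x < - s")
  case True
  then have "a \<in> armijo_steps F \<alpha>0 \<delta> \<gamma> x d"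
    using assms(1) unfolding refinement_def is_maximum_def by auto
  then have "0 < a" and *: "F (x + a *\<^sub>R d) \<le> F x + (\<gamma> * a * max_slope_all F x d) *\<^sub>R 1"
    using assms(2,3) unfolding armijo_steps_def by auto
  have "0 \<le> min 1 \<Gamma>1 * (norm (vdir F UNIV x))\<^sup>2" using assms(5) by simp
  then have "max_slope_all F x d \<le> 0"
    using refinement_slope(1)[OF assms(1)] by linarith
  then have "\<gamma> * a * max_slope_all F x d \<le> 0"
    using \<open>0 < a\<close> assms(4) by (simp add: mult_nonneg_nonpos)
  with * show ?thesis
    by (auto simp: less_eq_vec_def) (smt (verit))
next
  case False
  then show ?thesis using assms(1) unfolding refinement_def by simp
qed

section \<open>Nondomination and covering as invariants of the updates\<close>

text \<open>A good point may be deleted later, but only in favour of one at least as good. Allowing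
  equality of the images makes the relation reflexive and transitive, so it composes along all
  updates.\<close>

definition weakly_covers :: "(real^'n \<Rightarrow> real^'m) \<Rightarrow> (real^'n) set \<Rightarrow> (real^'n) set \<Rightarrow> bool" where
  "weakly_covers F Y' Y \<longleftrightarrow> (\<forall>y\<in>Y. \<exists>y'\<in>Y'. F y' \<le> F y)"

lemma weakly_covers_refl: "weakly_covers F Y Y"
  unfolding weakly_covers_def by blast

lemma weakly_covers_trans:
  "weakly_covers F Y2 Y1 \<Longrightarrow> weakly_covers F Y1 Y0 \<Longrightarrow> weakly_covers F Y2 Y0"
  unfolding weakly_covers_def by (meson order_trans)

lemma weakly_covers_insert_point: "weakly_covers F (insert_point F z Y) (insert z Y)"
  unfolding weakly_covers_def insert_point_def dominates_def by auto

lemma weakly_covers_mono: "weakly_covers F Y' Y \<Longrightarrow> Z \<subseteq> Y \<Longrightarrow> weakly_covers F Y' Z"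
  unfolding weakly_covers_def by blast

text \<open>The update itself removes whatever \<open>z\<close> dominates, so only domination of
  \<open>z\<close> by an old point has to be excluded.\<close>

lemma mutually_nondominated_insert_point:
  assumes "mutually_nondominated F Y" "\<And>y. y \<in> Y \<Longrightarrow> \<not> dominates F y z"
  shows "mutually_nondominated F (insert_point F z Y)"
  using assms unfolding mutually_nondominated_def insert_point_def
  by (auto simp: dominates_def)

text \<open>The exploration stepsize makes \<open>w\<close> strictly better than each current point
  in some component, hence no current point dominates \<open>w\<close>.\<close>

lemma exploration_invariant:
  assumes "exploration F \<alpha>0 \<delta> z Is Y Y' W" "mutually_nondominated F Y"
  shows "mutually_nondominated F Y' \<and> weakly_covers F Y' Y"
  using assms
proof (induction rule: exploration.induct)
  case (explore Y I a w Is Y' W)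
  have "\<forall>y\<in>Y. \<exists>j. F w $ j < F y $ j"
    using explore.hyps(2,3) unfolding is_maximum_def exploration_steps_def by auto
  then have "\<not> dominates F y w" if "y \<in> Y" for y
    using that unfolding dominates_def less_eq_vec_def by (metis not_less)
  then have "mutually_nondominated F (insert_point F w Y)"
    using mutually_nondominated_insert_point explore.prems by blast
  with explore.IH show ?case
    using weakly_covers_trans weakly_covers_mono[OF weakly_covers_insert_point] by blast
qed (auto simp: weakly_covers_refl)

text \<open>A point dominating the refined point \<open>z\<close> would also dominate
  \<open>x\<close>, since \<open>F z \<le> F x\<close>, and \<open>x\<close> still belongs to the
  nondominated set \<open>Y\<close>. The last conjunct remembers that \<open>z\<close> stays covered
  even if exploration deletes it.\<close>

lemma process_point_invariant:
  assumes "process_point F \<alpha>0 \<delta> \<gamma> \<Gamma>1 \<Gamma>2 s x Y Y' G"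
    and "x \<in> Y" "mutually_nondominated F Y" "0 < \<alpha>0" "0 < \<delta>" "0 < \<gamma>" "0 < \<Gamma>1"
  shows "mutually_nondominated F Y' \<and> weakly_covers F Y' Y \<and>
    (\<exists>d a. refinement F \<alpha>0 \<delta> \<gamma> \<Gamma>1 \<Gamma>2 s x d a \<and> weakly_covers F Y' {x + a *\<^sub>R d})"
proof -
  from assms(1) obtain d a z Is W where r: "refinement F \<alpha>0 \<delta> \<gamma> \<Gamma>1 \<Gamma>2 s x d a"
    and z: "z = x + a *\<^sub>R d" and e: "exploration F \<alpha>0 \<delta> z Is (insert_point F z Y) Y' W"
    unfolding process_point_def by (elim exE conjE)
  have zx: "F z \<le> F x" unfolding z by (rule refinement_decrease[OF r assms(4-7)])
  have "\<not> dominates F y z" if "y \<in> Y" for y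
  proof
    assume "dominates F y z"
    then have "dominates F y x" using zx unfolding dominates_def by force
    then show False using that assms(2,3) unfolding mutually_nondominated_def by blast
  qed
  then have "mutually_nondominated F (insert_point F z Y)"
    using mutually_nondominated_insert_point assms(3) by blast
  from exploration_invariant[OF e this]
  have "mutually_nondominated F Y'" "weakly_covers F Y' (insert z Y)"
    using weakly_covers_trans weakly_covers_insert_point by blast+
  then show ?thesis using r z weakly_covers_mono by blast
qed

text \<open>A pair in the log certifies that its first entry was processed and not skipped; the last
  conjunct extracts from this a refinement point that the final set still covers.\<close>

lemma iteration_invariant:
  assumes "iteration F \<alpha>0 \<delta> \<gamma> \<Gamma>1 \<Gamma>2 s xs Y Y' L"
    and "mutually_nondominated F Y" "0 < \<alpha>0" "0 < \<delta>" "0 < \<gamma>" "0 < \<Gamma>1"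
  shows "mutually_nondominated F Y' \<and> weakly_covers F Y' Y \<and>
    (\<forall>(x, y)\<in>L. \<exists>d a. refinement F \<alpha>0 \<delta> \<gamma> \<Gamma>1 \<Gamma>2 s x d a \<and> weakly_covers F Y' {x + a *\<^sub>R d})"
  using assms
proof (induction rule: iteration.induct)
  case (process x Y Y' G xs Y'' L)
  note P = process_point_invariant[OF process.hyps(2,1) process.prems]
  then have Q: "mutually_nondominated F Y''" "weakly_covers F Y'' Y'"
    "\<forall>(x, y)\<in>L. \<exists>d a. refinement F \<alpha>0 \<delta> \<gamma> \<Gamma>1 \<Gamma>2 s x d a \<and> weakly_covers F Y'' {x + a *\<^sub>R d}"
    using process.IH process.prems by blast+
  have "\<exists>d a. refinement F \<alpha>0 \<delta> \<gamma> \<Gamma>1 \<Gamma>2 s x d a \<and> weakly_covers F Y'' {x + a *\<^sub>R d}"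
    using P Q(2) weakly_covers_trans by blast
  moreover have "weakly_covers F Y'' Y" using P Q(2) weakly_covers_trans by blast
  ultimately show ?case using Q(1,3) by blast
qed (auto simp: weakly_covers_refl)

text \<open>If \<open>y\<close> were worse than \<open>p\<close> in all components, the point
  covering \<open>p\<close> would dominate \<open>y\<close>. This hands the quality of
  \<open>p\<close> on, in one component, to every member of a later set.\<close>

lemma mutually_nondominated_component_le:
  fixes F :: "real^'n \<Rightarrow> real^'m"
  assumes "mutually_nondominated F Y" "weakly_covers F Y {p}" "y \<in> Y"
  shows "\<exists>j. F y $ j \<le> F p $ j"
proof (rule ccontr)
  assume *: "\<not> ?thesis"
  obtain q where q: "q \<in> Y" "F q \<le> F p" using assms(2) unfolding weakly_covers_def by blast
  have "F q $ j < F y $ j" for j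
    using q(2) * unfolding less_eq_vec_def by (meson le_less_trans not_le)
  then have "dominates F q y"
    unfolding dominates_def less_eq_vec_def by (metis less_imp_le less_irrefl)
  then show False using assms(1,3) q(1) unfolding mutually_nondominated_def by blast
qed

section \<open>Uniform decrease near a nonstationary point\<close>

text \<open>By the mean value theorem the increment is \<open>t\<close> times a slope at a nearby
  point, and the gap between \<open>D\<close> and \<open>\<gamma> * D\<close> absorbs the change of
  gradient. Only bounds on \<open>d\<close> and its slope enter, so the estimate covers arbitrarily
  chosen directions.\<close>

lemma armijo_uniform:
  fixes F :: "real^'n \<Rightarrow> real^'m"
  assumes "continuously_differentiable F" "\<gamma> < 1" "0 < c" "0 < M"
  shows "\<exists>\<eta>>0. \<forall>\<^sub>F x in nhds xbar. \<forall>d t. norm d \<le> M \<longrightarrow> max_slope_all F x d \<le> - c \<longrightarrow>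
           0 < t \<longrightarrow> t \<le> \<eta> \<longrightarrow> F (x + t *\<^sub>R d) \<le> F x + (\<gamma> * t * max_slope_all F x d) *\<^sub>R 1"
proof -
  \<comment> \<open>Two gradients near \<open>xbar\<close> differ by at most
    \<open>2 * \<omega>\<close>; against a direction of norm at most \<open>M\<close> this costs
    \<open>(1 - \<gamma>) * c\<close>.\<close>
  define \<omega> where "\<omega> = (1 - \<gamma>) * c / (2 * M)"
  have "\<omega> > 0" using assms by (simp add: \<omega>_def)
  have "\<forall>\<^sub>F y in nhds xbar. \<forall>j. dist (grad F j y) (grad F j xbar) < \<omega>"
  proof (intro eventually_all_finite)
    fix j
    show "\<forall>\<^sub>F y in nhds xbar. dist (grad F j y) (grad F j xbar) < \<omega>"
      using tendsto_grad[OF assms(1)] \<open>\<omega> > 0\<close> by (rule tendstoD)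
  qed
  then obtain \<rho> where \<rho>: "\<rho> > 0" "\<And>y j. dist y xbar < \<rho> \<Longrightarrow> dist (grad F j y) (grad F j xbar) < \<omega>"
    unfolding eventually_nhds_metric by blast
  show ?thesis
  proof (intro exI conjI)
    \<comment> \<open>With this bound a step moves by at most \<open>\<rho> / 2\<close>, so starting
      within \<open>\<rho> / 2\<close> of \<open>xbar\<close> the whole segment stays in the ball of
      radius \<open>\<rho>\<close>.\<close>
    show "0 < \<rho> / (2 * M)" using \<rho>(1) assms(4) by simp
    have "\<forall>\<^sub>F x in nhds xbar. dist x xbar < \<rho> / 2"
      using \<rho>(1) by (auto simp: eventually_nhds_metric intro!: exI[of _ "\<rho> / 2"])
    then show "\<forall>\<^sub>F x in nhds xbar. \<forall>d t. norm d \<le> M \<longrightarrow> max_slope_all F x d \<le> - c \<longrightarrow>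
           0 < t \<longrightarrow> t \<le> \<rho> / (2 * M) \<longrightarrow> F (x + t *\<^sub>R d) \<le> F x + (\<gamma> * t * max_slope_all F x d) *\<^sub>R 1"
    proof (rule eventually_mono, intro allI impI)
      fix x d t
      assume x: "dist x xbar < \<rho> / 2" and d: "norm d \<le> M" "max_slope_all F x d \<le> - c"
        and t: "0 < t" "t \<le> \<rho> / (2 * M)"
      let ?D = "max_slope_all F x d"
      have "F (x + t *\<^sub>R d) $ j \<le> F x $ j + \<gamma> * t * ?D" for j
      proof -
        obtain s where s: "0 < s" "s < t"
          "F (x + t *\<^sub>R d) $ j - F x $ j = t * (grad F j (x + s *\<^sub>R d) \<bullet> d)"
          using grad_mean_value[OF assms(1) t(1)] .
        have "s * norm d \<le> \<rho> / (2 * M) * M"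
          using s t d by (intro mult_mono) auto
        then have "dist (x + s *\<^sub>R d) x \<le> \<rho> / 2"
          using s(1) assms(4) by (simp add: dist_norm)
        with x have "dist (x + s *\<^sub>R d) xbar < \<rho>" "dist x xbar < \<rho>"
          using dist_triangle[of "x + s *\<^sub>R d" xbar x] \<rho>(1) by auto
        from \<rho>(2)[OF this(1), of j] \<rho>(2)[OF this(2), of j]
        have "norm (grad F j (x + s *\<^sub>R d) - grad F j x) \<le> 2 * \<omega>"
          using dist_triangle2[of "grad F j (x + s *\<^sub>R d)" "grad F j x" "grad F j xbar"]
          by (simp add: dist_norm)
        then have "norm (grad F j (x + s *\<^sub>R d) - grad F j x) * norm d \<le> 2 * \<omega> * M"
          using d(1) \<open>\<omega> > 0\<close> by (intro mult_mono) auto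
        also have "\<dots> = (1 - \<gamma>) * c" using assms(4) by (simp add: \<omega>_def)
        also have "\<dots> \<le> (1 - \<gamma>) * (- ?D)" using d(2) assms(2) by (intro mult_left_mono) auto
        finally have "(grad F j (x + s *\<^sub>R d) - grad F j x) \<bullet> d \<le> (1 - \<gamma>) * (- ?D)"
          using norm_cauchy_schwarz order_trans by blast
        moreover have "grad F j x \<bullet> d \<le> ?D" by (rule max_slope_ge) simp
        ultimately have "grad F j (x + s *\<^sub>R d) \<bullet> d \<le> \<gamma> * ?D"
          by (simp add: inner_diff_left algebra_simps)
        then have "t * (grad F j (x + s *\<^sub>R d) \<bullet> d) \<le> t * (\<gamma> * ?D)"
          using t(1) by simp
        with s(3) show ?thesis by (simp add: algebra_simps)
      qed
      then show "F (x + t *\<^sub>R d) \<le> F x + (\<gamma> * t * ?D) *\<^sub>R 1"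
        by (simp add: less_eq_vec_def)
    qed
  qed
qed

text \<open>One fixed trial vector, a descent direction at \<open>xbar\<close> suitably scaled,
  bounds \<open>theta\<close> from above at all nearby points; continuity of the gradients then
  suffices.\<close>

lemma theta_uniformly_negative:
  fixes F :: "real^'n \<Rightarrow> real^'m"
  assumes "continuously_differentiable F" "\<not> pareto_stationary F xbar"
  shows "\<exists>\<epsilon>>0. \<forall>\<^sub>F x in nhds xbar. theta F UNIV x < - \<epsilon>"
proof -
  have "max_slope_all F xbar 0 = 0"
    using max_slope_scaleR[of UNIV 0 F xbar 0] by simp
  then have "0 \<in> range (max_slope_all F xbar)" by (metis rangeI)
  then obtain d where d: "max_slope_all F xbar d < 0"
    using assms(2) unfolding pareto_stationary_def is_minimum_def by (auto simp: not_le)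
  define D where "D = max_slope_all F xbar d"
  \<comment> \<open>The scaling gives \<open>t * (norm d)\<^sup>2 \<le> - D\<close>, so half of the
    linear gain pays for the quadratic term; the \<open>+ 1\<close> avoids a separate case
    \<open>d = 0\<close>.\<close>
  define t where "t = - D / ((norm d)\<^sup>2 + 1)"
  have pos: "(norm d)\<^sup>2 + 1 > 0" by (simp add: add_nonneg_pos)
  have t: "t > 0" unfolding t_def by (rule divide_pos_pos[OF _ pos]) (use d in \<open>simp add: D_def\<close>)
  have "t * ((norm d)\<^sup>2 + 1) = - D"
    using pos by (simp add: t_def)
  moreover have "t * (norm d)\<^sup>2 \<le> t * ((norm d)\<^sup>2 + 1)" using t by simp
  ultimately have "t * (norm d)\<^sup>2 \<le> - D" by linarith
  \<comment> \<open>Near \<open>xbar\<close> three quarters of the gain \<open>t * D\<close>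
    survive; after paying one half, a quarter is left.\<close>
  define \<epsilon> where "\<epsilon> = - t * D / 4"
  have "\<epsilon> > 0" using t d by (simp add: \<epsilon>_def D_def mult_pos_neg)
  have quad: "t * D / 2 + (norm (t *\<^sub>R d))\<^sup>2 / 2 \<le> 0"
  proof -
    have "t * (t * (norm d)\<^sup>2) \<le> t * (- D)"
      using \<open>t * (norm d)\<^sup>2 \<le> - D\<close> t by (intro mult_left_mono) auto
    then show ?thesis by (simp add: power_mult_distrib power2_eq_square algebra_simps)
  qed
  have "\<forall>\<^sub>F x in nhds xbar. \<forall>j. grad F j x \<bullet> (t *\<^sub>R d) < 3 * t * D / 4"
  proof (intro eventually_all_finite)
    fix j
    have "((\<lambda>x. grad F j x \<bullet> (t *\<^sub>R d)) \<longlongrightarrow> grad F j xbar \<bullet> (t *\<^sub>R d)) (nhds xbar)"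
      by (intro tendsto_intros tendsto_grad assms(1))
    moreover have "grad F j xbar \<bullet> (t *\<^sub>R d) < 3 * t * D / 4"
    proof -
      have "grad F j xbar \<bullet> d \<le> D" unfolding D_def by (rule max_slope_ge) simp
      then have "t * (grad F j xbar \<bullet> d) \<le> t * D" using t by simp
      then show ?thesis using \<open>\<epsilon> > 0\<close> by (simp add: \<epsilon>_def)
    qed
    ultimately show "\<forall>\<^sub>F x in nhds xbar. grad F j x \<bullet> (t *\<^sub>R d) < 3 * t * D / 4"
      by (rule order_tendstoD(2))
  qed
  then have "\<forall>\<^sub>F x in nhds xbar. theta F UNIV x < - \<epsilon>"
  proof (rule eventually_mono)
    fix x assume "\<forall>j. grad F j x \<bullet> (t *\<^sub>R d) < 3 * t * D / 4"
    then have "max_slope_all F x (t *\<^sub>R d) < 3 * t * D / 4"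
      by (subst max_slope_less_iff) auto
    with quad theta_le[of UNIV F x "t *\<^sub>R d"] show "theta F UNIV x < - \<epsilon>"
      by (simp add: \<epsilon>_def)
  qed
  with \<open>\<epsilon> > 0\<close> show ?thesis by blast
qed

lemma refinement_uniform_decrease:
  fixes F :: "real^'n \<Rightarrow> real^'m"
  assumes "continuously_differentiable F" "\<not> pareto_stationary F xbar"
    and "0 < \<alpha>0" "0 < \<delta>" "\<delta> < 1" "0 < \<gamma>" "\<gamma> < 1" "0 < \<Gamma>1"
  shows "\<exists>\<epsilon>>0. \<exists>\<kappa>>0. \<forall>\<^sub>F x in nhds xbar. \<forall>s d a j. s \<le> \<epsilon> \<longrightarrow>
    refinement F \<alpha>0 \<delta> \<gamma> \<Gamma>1 \<Gamma>2 s x d a \<longrightarrow> F (x + a *\<^sub>R d) $ j \<le> F x $ j - \<kappa>"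
proof -
  obtain \<epsilon> where \<epsilon>: "\<epsilon> > 0" "\<forall>\<^sub>F x in nhds xbar. theta F UNIV x < - \<epsilon>"
    using theta_uniformly_negative[OF assms(1,2)] by blast
  \<comment> \<open>Any single index will do, since \<open>norm_vdir_le\<close> bounds
    \<open>vdir\<close> by each gradient.\<close>
  fix i :: 'm
  define B where "B = norm (grad F i xbar) + 1"
  define M where "M = max 1 \<Gamma>2 * B"
  \<comment> \<open>The factor \<open>2 * \<epsilon>\<close> arises because \<open>theta\<close>
    equals minus half the squared norm of \<open>vdir\<close>.\<close>
  define c where "c = min 1 \<Gamma>1 * (2 * \<epsilon>)"
  have "B > 0" by (simp add: B_def add_nonneg_pos)
  have "M > 0" using \<open>B > 0\<close> by (simp add: M_def)
  have "c > 0" using \<epsilon>(1) assms by (simp add: c_def)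
  have "((\<lambda>x. norm (grad F i x)) \<longlongrightarrow> norm (grad F i xbar)) (nhds xbar)"
    by (intro tendsto_norm tendsto_grad assms(1))
  then have bound: "\<forall>\<^sub>F x in nhds xbar. norm (grad F i x) < B"
    by (rule order_tendstoD(2)) (simp add: B_def)
  obtain \<eta> where "\<eta> > 0" and arm: "\<forall>\<^sub>F x in nhds xbar. \<forall>d t. norm d \<le> M \<longrightarrow>
      max_slope_all F x d \<le> - c \<longrightarrow> 0 < t \<longrightarrow> t \<le> \<eta> \<longrightarrow>
      F (x + t *\<^sub>R d) \<le> F x + (\<gamma> * t * max_slope_all F x d) *\<^sub>R 1"
    using armijo_uniform[OF assms(1,7) \<open>c > 0\<close> \<open>M > 0\<close>] by blast
  \<comment> \<open>A trial step below \<open>\<eta>\<close> that is itself of the form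
    \<open>\<alpha>0 * \<delta> ^ h\<close> lies in the Armijo set, so the maximal step
    \<open>a\<close> is at least \<open>t\<close>.\<close>
  obtain h where h: "\<delta> ^ h < \<eta> / \<alpha>0"
    using real_arch_pow_inv[of "\<eta> / \<alpha>0" \<delta>] \<open>\<eta> > 0\<close> assms by auto
  define t where "t = \<alpha>0 * \<delta> ^ h"
  have t: "0 < t" "t \<le> \<eta>" using h assms by (auto simp: t_def field_simps)
  define \<kappa> where "\<kappa> = \<gamma> * t * c"
  have "\<kappa> > 0" using t \<open>c > 0\<close> assms by (simp add: \<kappa>_def)
  have "\<forall>\<^sub>F x in nhds xbar. \<forall>s d a j. s \<le> \<epsilon> \<longrightarrow>
    refinement F \<alpha>0 \<delta> \<gamma> \<Gamma>1 \<Gamma>2 s x d a \<longrightarrow> F (x + a *\<^sub>R d) $ j \<le> F x $ j - \<kappa>"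
    using \<epsilon>(2) bound arm
  proof eventually_elim
    case (elim x)
    show ?case
    proof (intro allI impI)
      fix s d a j
      assume s: "s \<le> \<epsilon>" and r: "refinement F \<alpha>0 \<delta> \<gamma> \<Gamma>1 \<Gamma>2 s x d a"
      let ?v = "vdir F UNIV x"
      have "theta F UNIV x < - s" using s elim(1) by linarith
      then have a: "is_maximum (armijo_steps F \<alpha>0 \<delta> \<gamma> x d) a"
        using r unfolding refinement_def by auto
      have "norm ?v \<le> B" using norm_vdir_le[of i UNIV F x] elim(2) by simp
      then have "max 1 \<Gamma>2 * norm ?v \<le> M" unfolding M_def by (intro mult_left_mono) auto
      then have d: "norm d \<le> M" using refinement_slope(2)[OF r] by linarith
      have "2 * \<epsilon> \<le> (norm ?v)\<^sup>2"
        using elim(1) theta_vdir[of UNIV F x] max_slope_vdir[of UNIV F x] by simp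
      then have "c \<le> min 1 \<Gamma>1 * (norm ?v)\<^sup>2"
        unfolding c_def using assms by (intro mult_left_mono) auto
      then have D: "max_slope_all F x d \<le> - c" using refinement_slope(1)[OF r] by linarith
      have "t \<in> armijo_steps F \<alpha>0 \<delta> \<gamma> x d"
        using elim(3) d D t unfolding armijo_steps_def t_def by blast
      then have "t \<le> a" using a unfolding is_maximum_def by blast
      have "F (x + a *\<^sub>R d) \<le> F x + (\<gamma> * a * max_slope_all F x d) *\<^sub>R 1"
        using a unfolding is_maximum_def armijo_steps_def by auto
      then have "F (x + a *\<^sub>R d) $ j \<le> F x $ j + \<gamma> * a * max_slope_all F x d"
        by (simp add: less_eq_vec_def)
      moreover have "\<kappa> \<le> \<gamma> * a * (- max_slope_all F x d)"
        unfolding \<kappa>_def using \<open>t \<le> a\<close> D t \<open>c > 0\<close> assms by (intro mult_mono) auto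
      ultimately show "F (x + a *\<^sub>R d) $ j \<le> F x $ j - \<kappa>" by simp
    qed
  qed
  with \<epsilon>(1) \<open>\<kappa> > 0\<close> show ?thesis by blast
qed

section \<open>Compactness of the iterates and the contradiction along a subsequence\<close>

theorem proposition5p5:
  fixes F :: "real^'n \<Rightarrow> real^'m"
    and \<alpha>0 \<delta> \<gamma> \<Gamma>1 \<Gamma>2 :: real
    and \<sigma> :: "nat \<Rightarrow> real"
    and X :: "nat \<Rightarrow> (real^'n) set"
    and Gen :: "nat \<Rightarrow> ((real^'n) \<times> (real^'n)) set"
    and x0 :: "real^'n"
    and x :: "nat \<Rightarrow> real^'n"
  assumes "continuously_differentiable F"
    and "\<alpha>0 > 0" and "0 < \<delta>" "\<delta> < 1" and "0 < \<gamma>" "\<gamma> < 1" and "\<Gamma>1 > 0" and "\<Gamma>2 > 0"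
    and "\<And>k. \<sigma> k \<ge> 0" and "\<sigma> \<longlonglongrightarrow> 0"
    and "X 0 \<noteq> {}" and "finite (X 0)" and "mutually_nondominated F (X 0)"
    and "x0 \<in> X 0"
    and "compact (\<Union>j. {y. F y $ j \<le> F x0 $ j})"
    and "front_descent_run F \<alpha>0 \<delta> \<gamma> \<Gamma>1 \<Gamma>2 \<sigma> X Gen"
    and "linked_sequence X Gen x"
  shows "(\<exists>xbar. accumulation_point x xbar) \<and>
         (\<forall>xbar. accumulation_point x xbar \<longrightarrow> pareto_stationary F xbar)"
proof -
  have iter: "mutually_nondominated F (X (Suc k)) \<and> weakly_covers F (X (Suc k)) (X k) \<and>
      (\<forall>(x, y)\<in>Gen k. \<exists>d a. refinement F \<alpha>0 \<delta> \<gamma> \<Gamma>1 \<Gamma>2 (\<sigma> k) x d a \<and>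
        weakly_covers F (X (Suc k)) {x + a *\<^sub>R d})"
    if "mutually_nondominated F (X k)" for k
    using assms(16) iteration_invariant[OF _ that assms(2,3,5,7)]
    unfolding front_descent_run_def by blast
  have nd: "mutually_nondominated F (X k)" for k
    using assms(13) iter by (induction k) auto
  have cov: "weakly_covers F (X l) (X k)" if "k \<le> l" for k l
    using that
  proof (induction rule: dec_induct)
    case (step n)
    then show ?case using iter[OF nd] weakly_covers_trans by blast
  qed (rule weakly_covers_refl)
  have xX: "x k \<in> X k" and gen: "(x k, x (Suc k)) \<in> Gen k" for k
    using assms(17) unfolding linked_sequence_def by blast+
  \<comment> \<open>Every later set covers \<open>x0\<close>, so each iterate is no worse than
    \<open>x0\<close> in some component: this is membership in the union of sublevel sets.\<close>
  have "x k \<in> (\<Union>j. {y. F y $ j \<le> F x0 $ j})" for k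
    using mutually_nondominated_component_le[OF nd weakly_covers_mono[OF cov[of 0 k]] xX, of x0]
      assms(14) by auto
  then have "\<exists>xbar. accumulation_point x xbar"
    using assms(15) unfolding compact_def accumulation_point_def by blast
  moreover have "pareto_stationary F xbar" if acc: "accumulation_point x xbar" for xbar
  proof (rule ccontr)
    assume "\<not> pareto_stationary F xbar"
    from refinement_uniform_decrease[OF assms(1) this assms(2-7), of \<Gamma>2]
    obtain \<epsilon> \<kappa> where "\<epsilon> > 0" "\<kappa> > 0" and dec: "\<forall>\<^sub>F y in nhds xbar. \<forall>s d a j. s \<le> \<epsilon> \<longrightarrow>
      refinement F \<alpha>0 \<delta> \<gamma> \<Gamma>1 \<Gamma>2 s y d a \<longrightarrow> F (y + a *\<^sub>R d) $ j \<le> F y $ j - \<kappa>"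
      by blast
    obtain r where r: "strict_mono r" "(x \<circ> r) \<longlonglongrightarrow> xbar"
      using acc unfolding accumulation_point_def by blast
    have "isCont F xbar"
      using assms(1) unfolding continuously_differentiable_def
      by (simp add: differentiable_imp_continuous_within)
    from isCont_tendsto_compose[OF this r(2)] have "(\<lambda>k. F (x (r k))) \<longlonglongrightarrow> F xbar"
      by simp
    then have "\<forall>\<^sub>F k in sequentially. dist (F (x (r k))) (F xbar) < \<kappa> / 2"
      using \<open>\<kappa> > 0\<close> by (intro tendstoD) auto
    moreover have "\<forall>\<^sub>F k in sequentially. \<sigma> (r k) < \<epsilon>"
      using order_tendstoD(2)[OF LIMSEQ_subseq_LIMSEQ[OF assms(10) r(1)] \<open>\<epsilon> > 0\<close>] by simp
    moreover have "\<forall>\<^sub>F k in sequentially. \<forall>s d a j. s \<le> \<epsilon> \<longrightarrow>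
      refinement F \<alpha>0 \<delta> \<gamma> \<Gamma>1 \<Gamma>2 s (x (r k)) d a \<longrightarrow>
        F (x (r k) + a *\<^sub>R d) $ j \<le> F (x (r k)) $ j - \<kappa>"
      using eventually_compose_filterlim[OF dec r(2)] by simp
    ultimately have "\<forall>\<^sub>F k in sequentially. dist (F (x (r k))) (F xbar) < \<kappa> / 2 \<and>
      \<sigma> (r k) < \<epsilon> \<and> (\<forall>s d a j. s \<le> \<epsilon> \<longrightarrow>
      refinement F \<alpha>0 \<delta> \<gamma> \<Gamma>1 \<Gamma>2 s (x (r k)) d a \<longrightarrow>
        F (x (r k) + a *\<^sub>R d) $ j \<le> F (x (r k)) $ j - \<kappa>)"
      by (intro eventually_conj)
    \<comment> \<open>Closeness is needed at two consecutive indices of the subsequence, the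
      refinement estimate only at the first.\<close>
    then obtain k where close: "dist (F (x (r k))) (F xbar) < \<kappa> / 2"
        "dist (F (x (r (Suc k)))) (F xbar) < \<kappa> / 2"
      and k: "\<sigma> (r k) < \<epsilon>" "\<And>s d a j. s \<le> \<epsilon> \<Longrightarrow>
        refinement F \<alpha>0 \<delta> \<gamma> \<Gamma>1 \<Gamma>2 s (x (r k)) d a \<Longrightarrow>
        F (x (r k) + a *\<^sub>R d) $ j \<le> F (x (r k)) $ j - \<kappa>"
      unfolding eventually_sequentially by (meson le_Suc_eq order_refl)
    obtain d a where ref: "refinement F \<alpha>0 \<delta> \<gamma> \<Gamma>1 \<Gamma>2 (\<sigma> (r k)) (x (r k)) d a"
      and z: "weakly_covers F (X (Suc (r k))) {x (r k) + a *\<^sub>R d}"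
      using iter[OF nd] gen by blast
    \<comment> \<open>The refined point is covered from iteration \<open>Suc (r k)\<close> on, and
      the next subsequence element occurs no earlier.\<close>
    have "Suc (r k) \<le> r (Suc k)" using r(1) by (simp add: strict_mono_Suc_iff Suc_le_eq)
    then obtain j where "F (x (r (Suc k))) $ j \<le> F (x (r k) + a *\<^sub>R d) $ j"
      using mutually_nondominated_component_le[OF nd weakly_covers_trans[OF cov z] xX] by blast
    \<comment> \<open>The component \<open>j\<close> is not under control, but the decrease by
      \<open>\<kappa>\<close> holds in every component.\<close>
    also have "\<dots> \<le> F (x (r k)) $ j - \<kappa>" by (rule k(2)[OF less_imp_le[OF k(1)] ref])
    finally have "\<kappa> \<le> F (x (r k)) $ j - F (x (r (Suc k))) $ j" by simp
    also have "\<dots> \<le> dist (F (x (r k))) (F (x (r (Suc k))))"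
      using component_le_norm_cart[of "F (x (r k)) - F (x (r (Suc k)))" j]
      by (simp add: dist_norm)
    also have "\<dots> < \<kappa>" using close dist_triangle2[of "F (x (r k))" "F (x (r (Suc k)))" "F xbar"]
      by linarith
    finally show False by simp
  qed
  ultimately show ?thesis by blast
qed

end
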